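(* Let $H$ be a fixed graph with no isolated vertices. Every non-trivial monotone increasing graph property $\mathcal{P}$ has a threshold in the binomial random motif graph $G(H,n,p)$. That is, there exists a function $p^*=p^*(n)$ such that \[ \lim_{n\to\infty}\Pr{G(H,n,p)\in\mathcal{P}}=\begin{cases}0 & \text{if } p/p^*\to 0,\\ 1 & \text{if } p/p^*\to\infty.\end{cases} \]
   Context: For a fixed graph $H$ (without isolated vertices) and an integer $n$, a copy of $H$ in $K_n$ is a subgraph of the complete graph on vertex set $[n]$ isomorphic to $H$; there are $\binom{n}{|V(H)|}\cdot|V(H)|!/\mathrm{aut}(H)$ of them, where $\mathrm{aut}(H)$ is the number of automorphisms of $H$. The binomial random motif graph $G(H,n,p)$ is the random (multi)graph on $[n]$ obtained by including each copy of $H$ in $K_n$ independently with probability $p$ and taking the (multigraph) union of the included copies. A property is monotone increasing if it is preserved under adding edges; non-trivial means it is neither always satisfied nor never satisfied. The paper defines thresholds only for monotone increasing properties, as in the claim. *)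

theory Defs
  imports "HOL-Probability.Probability" "HOL-Library.Multiset"
begin

datatype 'a ugraph = UGraph (verts: "'a set") (edges: "'a set set")

definition finite_simple_graph :: "'a ugraph \<Rightarrow> bool" where
  "finite_simple_graph G \<longleftrightarrow>
     finite (verts G) \<and> (\<forall>e\<in>edges G. e \<subseteq> verts G \<and> card e = 2)"

definition no_isolated_vertices :: "'a ugraph \<Rightarrow> bool" where
  "no_isolated_vertices G \<longleftrightarrow> (\<forall>v\<in>verts G. \<exists>e\<in>edges G. v \<in> e)"

definition isomorphic :: "'a ugraph \<Rightarrow> 'b ugraph \<Rightarrow> bool" where
  "isomorphic G G' \<longleftrightarrow>
     (\<exists>f. bij_betw f (verts G) (verts G') \<and> edges G' = (\<lambda>e. f ` e) ` edges G)"

definition is_subgraph :: "'a ugraph \<Rightarrow> 'a ugraph \<Rightarrow> bool" where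
  "is_subgraph C G \<longleftrightarrow>
     finite_simple_graph C \<and> verts C \<subseteq> verts G \<and> edges C \<subseteq> edges G"

definition complete_graph :: "nat \<Rightarrow> nat ugraph" where
  "complete_graph n = UGraph {1..n} {e. e \<subseteq> {1..n} \<and> card e = 2}"

definition copies :: "'a ugraph \<Rightarrow> nat \<Rightarrow> nat ugraph set" where
  "copies H n = {C. is_subgraph C (complete_graph n) \<and> isomorphic H C}"

text \<open>
  The vertex set of a multigraph is always \<open>{1..n}\<close> for an \<open>n\<close> given separately, so a
  multigraph is represented by its multiset of edges; loops are not allowed.
\<close>

type_synonym multigraph = "nat set multiset"

definition multigraphs :: "nat \<Rightarrow> multigraph set" where
  "multigraphs n = {G. set_mset G \<subseteq> edges (complete_graph n)}"

text \<open>The outcome \<open>X\<close> of the product distribution says which copies are included.\<close>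

definition random_motif_graph :: "'a ugraph \<Rightarrow> nat \<Rightarrow> real \<Rightarrow> multigraph pmf" where
  "random_motif_graph H n p =
     map_pmf (\<lambda>X. \<Sum>C\<in>{C \<in> copies H n. X C}. mset_set (edges C))
       (Pi_pmf (copies H n) False (\<lambda>_. bernoulli_pmf p))"

text \<open>
  A property is given by the set \<open>P n\<close> of the multigraphs on \<open>{1..n}\<close> that satisfy it, for
  every \<open>n\<close>. Closure under isomorphism is not required. A property of simple graphs is
  covered by asking it of the underlying simple graph \<open>set_mset G\<close>.
\<close>

definition graph_property :: "(nat \<Rightarrow> multigraph set) \<Rightarrow> bool" where
  "graph_property P \<longleftrightarrow> (\<forall>n. P n \<subseteq> multigraphs n)"

definition monotone_increasing :: "(nat \<Rightarrow> multigraph set) \<Rightarrow> bool" where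
  "monotone_increasing P \<longleftrightarrow>
     (\<forall>n. \<forall>G\<in>P n. \<forall>G'\<in>multigraphs n. G \<subseteq># G' \<longrightarrow> G' \<in> P n)"

text \<open>
  Non-triviality is required for all large \<open>n\<close> only: every property is trivial for
  \<open>n \<le> 1\<close>, where the edgeless graph is the only multigraph, and containing a fixed
  nonempty graph is never satisfied for small \<open>n\<close>.
\<close>

definition nontrivial :: "(nat \<Rightarrow> multigraph set) \<Rightarrow> bool" where
  "nontrivial P \<longleftrightarrow> (\<forall>\<^sub>F n in sequentially. P n \<noteq> {} \<and> P n \<noteq> multigraphs n)"

text \<open>Positivity of the threshold excludes the convention \<open>x / 0 = 0\<close>.\<close>

definition is_threshold ::
    "'a ugraph \<Rightarrow> (nat \<Rightarrow> multigraph set) \<Rightarrow> (nat \<Rightarrow> real) \<Rightarrow> bool" where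
  "is_threshold H P pstar \<longleftrightarrow>
     (\<forall>n. pstar n > 0) \<and>
     (\<forall>p. (\<forall>n. 0 \<le> p n \<and> p n \<le> 1) \<longrightarrow>
       ((\<lambda>n. p n / pstar n) \<longlonglongrightarrow> 0 \<longrightarrow>
         (\<lambda>n. measure_pmf.prob (random_motif_graph H n (p n)) (P n)) \<longlonglongrightarrow> 0) \<and>
       (filterlim (\<lambda>n. p n / pstar n) at_top sequentially \<longrightarrow>
         (\<lambda>n. measure_pmf.prob (random_motif_graph H n (p n)) (P n)) \<longlonglongrightarrow> 1))"

end

theory Submission
  imports Defs
begin

text \<open>
  This is the argument of Bollobas and Thomason. Let \<open>f p\<close> be the probability that a random set
  of density \<open>p\<close> lies in a fixed up-set, and let \<open>f t = 1 / 2\<close>. The union of \<open>k\<close> independent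
  samples of density \<open>p\<close> has density at most \<open>k * p\<close>, so \<open>1 - f (k * p) \<le> (1 - f p) ^ k\<close>, which
  is at most \<open>1 / (1 + k * f p)\<close>. The choice \<open>k \<approx> t / p\<close> bounds \<open>f p\<close> by a multiple of \<open>p / t\<close>, and
  the choice \<open>k \<approx> p / t\<close>, with \<open>p\<close> and \<open>t\<close> exchanged, bounds \<open>1 - f p\<close> by a multiple of \<open>t / p\<close>.
  Both bounds are uniform in the up-set, hence in \<open>n\<close>.
\<close>

section \<open>Bernoulli variables and independent pairs\<close>

lemma bernoulli_pmf_0: "bernoulli_pmf 0 = return_pmf False"
proof (rule pmf_eqI)
  show "pmf (bernoulli_pmf 0) b = pmf (return_pmf False) b" for b
    by (cases b) auto
qed

text \<open>A disjunction of independent bits is false only if both bits are, which has probability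
  \<open>(1 - p) * (1 - q)\<close>. This is the one-coordinate case of the union of two
  samples.\<close>

lemma bernoulli_pmf_disj:
  assumes "0 \<le> p" "p \<le> 1" "0 \<le> q" "q \<le> 1"
  shows "bernoulli_pmf (p + q - p * q) =
    bind_pmf (bernoulli_pmf p) (\<lambda>b. map_pmf ((\<or>) b) (bernoulli_pmf q))"
proof (rule pmf_eqI)
  fix b
  have "0 \<le> (1 - p) * (1 - q)" "0 \<le> p + q * (1 - p)"
    using assms by (intro mult_nonneg_nonneg add_nonneg_nonneg; simp)+
  then have r: "0 \<le> p + q - p * q" "p + q - p * q \<le> 1"
    by (auto simp: algebra_simps)
  have *: "map_pmf ((\<or>) True) (bernoulli_pmf q) = return_pmf True"
    "map_pmf ((\<or>) False) (bernoulli_pmf q) = bernoulli_pmf q"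
    by (simp_all add: fun_eq_iff map_pmf_const[symmetric] map_pmf_id[unfolded id_def]
      cong: map_pmf_cong)
  show "pmf (bernoulli_pmf (p + q - p * q)) b =
      pmf (bind_pmf (bernoulli_pmf p) (\<lambda>b. map_pmf ((\<or>) b) (bernoulli_pmf q))) b"
    using assms r
    by (cases b) (simp_all add: pmf_bind * algebra_simps del: map_pmf_const)
qed

text \<open>Cutting both sets down to the supports makes them countable, as
  \<open>measure_pmf_prob_product\<close> demands, and changes no probability.\<close>

lemma prob_pair_pmf_Times:
  "measure_pmf.prob (pair_pmf M N) (A \<times> B) = measure_pmf.prob M A * measure_pmf.prob N B"
proof -
  have "measure_pmf.prob (pair_pmf M N) (A \<times> B) =
      measure_pmf.prob (pair_pmf M N) ((A \<inter> set_pmf M) \<times> (B \<inter> set_pmf N))"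
    by (subst (1 2) measure_Int_set_pmf[symmetric]) (auto intro!: arg_cong2[where f = measure])
  also have "\<dots> = measure_pmf.prob M (A \<inter> set_pmf M) * measure_pmf.prob N (B \<inter> set_pmf N)"
    by (intro measure_pmf_prob_product) auto
  finally show ?thesis
    by (simp add: measure_Int_set_pmf)
qed

section \<open>Up-sets in a random subset of a finite set\<close>

definition upset_prob :: "'c set \<Rightarrow> ('c \<Rightarrow> bool) set \<Rightarrow> real \<Rightarrow> real" where
  "upset_prob A E p = measure_pmf.prob (Pi_pmf A False (\<lambda>_. bernoulli_pmf p)) E"

lemma upset_prob_nonneg: "0 \<le> upset_prob A E p"
  and upset_prob_le_1: "upset_prob A E p \<le> 1"
  by (simp_all add: upset_prob_def)

lemma upset_prob_0:
  assumes "finite A" "(\<lambda>_. False) \<notin> E"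
  shows "upset_prob A E 0 = 0"
  using assms by (simp add: upset_prob_def bernoulli_pmf_0 indicator_def)

text \<open>Only finitely many outcomes are possible, so on the unit interval the probability is a
  polynomial in \<open>p\<close>. Continuity supplies the median through the intermediate value
  theorem.\<close>

lemma continuous_on_upset_prob:
  fixes A :: "'c set"
  assumes A: "finite A"
  shows "continuous_on {0..1} (upset_prob A E)"
proof -
  define S where "S = PiE_dflt A False (\<lambda>_. UNIV :: bool set)"
  have S: "finite S"
    unfolding S_def using A by (rule finite_PiE_dflt) auto
  have supp: "set_pmf (Pi_pmf A False (\<lambda>_. bernoulli_pmf p)) \<subseteq> S" for p
    using set_Pi_pmf_subset'[OF A, of False "\<lambda>_. bernoulli_pmf p"]
    unfolding S_def PiE_dflt_def by auto
  have "upset_prob A E p = (\<Sum>X\<in>E \<inter> S. \<Prod>x\<in>A. if X x then p else 1 - p)"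
    if p: "p \<in> {0..1}" for p
  proof -
    have "upset_prob A E p = measure_pmf.prob (Pi_pmf A False (\<lambda>_. bernoulli_pmf p)) (E \<inter> S)"
      unfolding upset_prob_def using supp[of p]
      by (intro measure_prob_cong_0) (auto simp: set_pmf_eq)
    also have "\<dots> = (\<Sum>X\<in>E \<inter> S. pmf (Pi_pmf A False (\<lambda>_. bernoulli_pmf p)) X)"
      using S by (intro measure_measure_pmf_finite) auto
    also have "\<dots> = (\<Sum>X\<in>E \<inter> S. \<Prod>x\<in>A. pmf (bernoulli_pmf p) (X x))"
      using A by (intro sum.cong refl pmf_Pi') (auto simp: S_def PiE_dflt_def)
    also have "\<dots> = (\<Sum>X\<in>E \<inter> S. \<Prod>x\<in>A. if X x then p else 1 - p)"
      using p by (intro sum.cong prod.cong refl) auto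
    finally show ?thesis .
  qed
  moreover have "continuous_on {0..1}
      (\<lambda>p::real. \<Sum>X\<in>E \<inter> S. \<Prod>x\<in>A. if X x then p else 1 - p)"
  proof (intro continuous_on_sum continuous_on_prod)
    fix X :: "'c \<Rightarrow> bool" and x
    show "continuous_on {0..1} (\<lambda>p::real. if X x then p else 1 - p)"
      by (cases "X x") (auto intro!: continuous_intros)
  qed
  ultimately show ?thesis
    by (metis (no_types, lifting) continuous_on_cong)
qed

text \<open>The union of independent samples with densities \<open>p\<close> and \<open>q\<close> is a sample with density
  \<open>p + q - p * q\<close>, and it misses the up-set only if both samples do.\<close>

lemma upset_prob_union:
  assumes A: "finite A" and up: "\<forall>X\<in>E. \<forall>Y\<ge>X. Y \<in> E"
    and "0 \<le> p" "p \<le> 1" "0 \<le> q" "q \<le> 1"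
  shows "1 - upset_prob A E (p + q - p * q) \<le> (1 - upset_prob A E p) * (1 - upset_prob A E q)"
proof -
  let ?M = "\<lambda>p. Pi_pmf A False (\<lambda>_. bernoulli_pmf p)"
  have compl: "1 - upset_prob A E r = measure_pmf.prob (?M r) (- E)" for r
    unfolding upset_prob_def by (subst measure_pmf.prob_compl[symmetric]) (auto simp: Compl_eq_Diff_UNIV)
  have "?M (p + q - p * q) =
      bind_pmf (?M p) (\<lambda>X. Pi_pmf A False (\<lambda>x. map_pmf ((\<or>) (X x)) (bernoulli_pmf q)))"
    unfolding bernoulli_pmf_disj[OF assms(3-6)] by (rule Pi_pmf_bind[OF A])
  also have "\<dots> = bind_pmf (?M p) (\<lambda>X. map_pmf (\<lambda>Y x. X x \<or> Y x) (?M q))"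
  proof (intro bind_pmf_cong refl)
    fix X assume "X \<in> set_pmf (?M p)"
    \<comment> \<open>Both samples are \<open>False\<close> off \<open>A\<close>, so their pointwise
      disjunction already has the default value there.\<close>
    then have X: "\<not> X x" if "x \<notin> A" for x
      using set_Pi_pmf_subset[OF A, of False "\<lambda>_. bernoulli_pmf p"] that by auto
    have "Pi_pmf A False (\<lambda>x. map_pmf ((\<or>) (X x)) (bernoulli_pmf q)) =
        Pi_pmf A False (\<lambda>x. bind_pmf (bernoulli_pmf q) (\<lambda>b. return_pmf (X x \<or> b)))"
      by (simp add: map_pmf_def)
    also have "\<dots> = bind_pmf (?M q) (\<lambda>Y. Pi_pmf A False (\<lambda>x. return_pmf (X x \<or> Y x)))"
      by (rule Pi_pmf_bind[OF A])
    also have "\<dots> = map_pmf (\<lambda>Y x. X x \<or> Y x) (?M q)"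
      unfolding map_pmf_def
    proof (intro bind_pmf_cong refl)
      fix Y assume "Y \<in> set_pmf (?M q)"
      then have "\<not> Y x" if "x \<notin> A" for x
        using set_Pi_pmf_subset[OF A, of False "\<lambda>_. bernoulli_pmf q"] that by auto
      with X show "Pi_pmf A False (\<lambda>x. return_pmf (X x \<or> Y x)) = return_pmf (\<lambda>x. X x \<or> Y x)"
        using A by (auto simp: fun_eq_iff)
    qed
    finally show "Pi_pmf A False (\<lambda>x. map_pmf ((\<or>) (X x)) (bernoulli_pmf q)) =
        map_pmf (\<lambda>Y x. X x \<or> Y x) (?M q)" .
  qed
  also have "\<dots> = map_pmf (\<lambda>(X, Y) x. X x \<or> Y x) (pair_pmf (?M p) (?M q))"
    by (simp add: pair_pmf_def map_pmf_def bind_assoc_pmf bind_return_pmf)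
  finally have "1 - upset_prob A E (p + q - p * q) =
      measure_pmf.prob (pair_pmf (?M p) (?M q)) ((\<lambda>(X, Y) x. X x \<or> Y x) -` (- E))"
    by (simp add: compl)
  also have "\<dots> \<le> measure_pmf.prob (pair_pmf (?M p) (?M q)) ((- E) \<times> (- E))"
  proof (intro measure_pmf.finite_measure_mono subsetI)
    fix Z assume "Z \<in> (\<lambda>(X, Y) x. X x \<or> Y x) -` (- E)"
    then show "Z \<in> (- E) \<times> (- E)"
      using up[rule_format, of "fst Z" "\<lambda>x. fst Z x \<or> snd Z x"]
        up[rule_format, of "snd Z" "\<lambda>x. fst Z x \<or> snd Z x"]
      by (cases Z) (auto simp: le_fun_def)
  qed simp
  finally show ?thesis
    by (simp add: prob_pair_pmf_Times compl)
qed

text \<open>A sample of density \<open>r\<close> is a sample of density \<open>p\<close> united with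
  one of density \<open>q\<close>, where \<open>1 - r = (1 - p) * (1 - q)\<close>. Solving for
  \<open>q\<close> requires \<open>p \<noteq> 1\<close>.\<close>

lemma upset_prob_mono:
  assumes A: "finite A" and up: "\<forall>X\<in>E. \<forall>Y\<ge>X. Y \<in> E"
    and "0 \<le> p" "p \<le> r" "r \<le> 1"
  shows "upset_prob A E p \<le> upset_prob A E r"
proof (cases "p = 1")
  case True
  with assms show ?thesis by simp
next
  case False
  define q where "q = (r - p) / (1 - p)"
  have "q * (1 - p) = r - p" "0 \<le> q" "q \<le> 1"
    using assms(3-) False by (auto simp: q_def)
  moreover from this have r: "r = p + q - p * q"
    by (simp add: algebra_simps)
  ultimately have "1 - upset_prob A E r \<le> (1 - upset_prob A E p) * (1 - upset_prob A E q)"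
    unfolding r using assms by (intro upset_prob_union) auto
  also have "\<dots> \<le> 1 - upset_prob A E p"
    by (intro mult_left_le) (simp_all add: upset_prob_nonneg upset_prob_le_1)
  finally show ?thesis by simp
qed

text \<open>The first factor is at most \<open>(1 - f p) ^ k\<close> by repeated union, the second
  at most \<open>(1 + f p) ^ k\<close> by Bernoulli's inequality, and these powers multiply to
  \<open>(1 - f p ^ 2) ^ k\<close>.\<close>

lemma upset_prob_multiple:
  assumes A: "finite A" and up: "\<forall>X\<in>E. \<forall>Y\<ge>X. Y \<in> E"
    and "0 \<le> p" "real k * p \<le> 1"
  shows "(1 - upset_prob A E (real k * p)) * (1 + real k * upset_prob A E p) \<le> 1"
proof -
  let ?f = "upset_prob A E"
  have pow: "1 - ?f (real k * p) \<le> (1 - ?f p) ^ k" using assms(4)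
  proof (induction k)
    case (Suc k)
    have kp: "0 \<le> real k * p" "0 \<le> real k * p * p" "real k * p + p \<le> 1"
      using Suc.prems \<open>0 \<le> p\<close> by (simp_all add: algebra_simps)
    then have "real k * p \<le> 1" "p \<le> 1"
      using \<open>0 \<le> p\<close> by linarith+
    note kp = kp this
    have "0 \<le> real k * p + p - real k * p * p"
      using kp \<open>0 \<le> p\<close> mult_left_le[of p "real k * p"] by linarith
    \<comment> \<open>The union has density slightly below \<open>(k + 1) * p\<close>; monotonicity
      absorbs the product term.\<close>
    then have "1 - ?f (real (Suc k) * p) \<le> 1 - ?f (real k * p + p - real k * p * p)"
      using Suc.prems kp upset_prob_mono[OF A up, of "real k * p + p - real k * p * p" "real (Suc k) * p"]
      by (simp add: algebra_simps)
    also have "\<dots> \<le> (1 - ?f (real k * p)) * (1 - ?f p)"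
      using kp \<open>0 \<le> p\<close> by (intro upset_prob_union[OF A up]) auto
    also have "\<dots> \<le> (1 - ?f p) ^ k * (1 - ?f p)"
      using Suc.IH kp by (intro mult_right_mono) (auto simp: upset_prob_le_1)
    finally show ?case by (simp add: mult.commute)
  qed (simp add: upset_prob_nonneg)
  have "(1 - ?f (real k * p)) * (1 + real k * ?f p) \<le> (1 - ?f p) ^ k * (1 + ?f p) ^ k"
    using pow Bernoulli_inequality[of "?f p" k] upset_prob_nonneg[of A E p]
      upset_prob_le_1[of A E "real k * p"]
    by (intro mult_mono) (auto simp: upset_prob_le_1)
  also have "\<dots> = (1 - ?f p ^ 2) ^ k"
    by (simp add: power_mult_distrib[symmetric] power2_eq_square algebra_simps)
  also have "\<dots> \<le> 1"
    using upset_prob_nonneg[of A E p] upset_prob_le_1[of A E p]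
    by (intro power_le_one) (auto simp: power_le_one)
  finally show ?thesis .
qed

text \<open>The threshold \<open>t\<close> is a median. If no median exists, because even the full sample is unlikely
  to lie in \<open>E\<close>, then \<open>t = 1\<close> works, since \<open>p / t\<close> is then bounded.\<close>

lemma upset_prob_threshold:
  assumes A: "finite A" and up: "\<forall>X\<in>E. \<forall>Y\<ge>X. Y \<in> E"
    and E: "(\<lambda>_. False) \<notin> E"
  shows "\<exists>t>0. \<forall>p\<in>{0..1}. upset_prob A E p \<le> 2 * (p / t) \<and>
    (p / t) * (1 - upset_prob A E p) \<le> 2"
proof -
  let ?f = "upset_prob A E"
  \<comment> \<open>The inequality \<open>f t \<le> 1 / 2\<close> serves \<open>lower\<close>; the
    alternative serves \<open>upper\<close>.\<close>
  obtain t where t: "0 < t" "t \<le> 1" "?f t \<le> 1 / 2" "?f t = 1 / 2 \<or> t = 1"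
  proof (cases "?f 1 \<ge> 1 / 2")
    case True
    then obtain t where "0 \<le> t" "t \<le> 1" "?f t = 1 / 2"
      using IVT'[of ?f 0 "1 / 2" 1] continuous_on_upset_prob[OF A] upset_prob_0[OF A E] by auto
    moreover from this have "t \<noteq> 0"
      using upset_prob_0[OF A E] by auto
    ultimately show ?thesis
      using that[of t] by auto
  next
    case False
    then show ?thesis
      using that[of 1] by auto
  qed
  have lower: "?f p \<le> 2 * (p / t)" if p: "0 \<le> p" "p \<le> 1" for p
  \<comment> \<open>For \<open>p > t / 2\<close> the claimed bound exceeds 1. Otherwise, for
    positive \<open>p\<close>, \<open>t / p \<ge> 2\<close>, so rounding down loses at most a factor
    2.\<close>
  proof (cases "p = 0 \<or> p > t / 2")
    case True
    then show ?thesis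
    proof
      assume "p > t / 2"
      then have "1 \<le> 2 * (p / t)"
        using t by (simp add: field_simps)
      then show ?thesis
        using upset_prob_le_1[of A E p] by linarith
    qed (simp add: upset_prob_0[OF A E])
  next
    case False
    define k where "k = nat \<lfloor>t / p\<rfloor>"
    have pos: "0 < p" "p \<le> t / 2" "0 < t / p"
      using False p t by auto
    then have "real k \<le> t / p" "t / p - 1 \<le> real k"
      unfolding k_def by linarith+
    moreover have "2 \<le> t / p"
      using pos by (simp add: field_simps)
    ultimately have k: "real k \<le> t / p" "t / p \<le> 2 * real k"
      by linarith+
    have kt: "real k * p \<le> t"
      using k(1) pos by (simp add: field_simps)
    have "?f (real k * p) \<le> ?f t"
      using kt t p by (intro upset_prob_mono[OF A up]) auto
    then have half: "1 / 2 \<le> 1 - ?f (real k * p)"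
      using t by simp
    have "1 / 2 * (1 + real k * ?f p) \<le> (1 - ?f (real k * p)) * (1 + real k * ?f p)"
      using half by (intro mult_right_mono) (auto simp: upset_prob_nonneg)
    also have "\<dots> \<le> 1"
      using kt t p by (intro upset_prob_multiple[OF A up]) auto
    finally have kf: "real k * ?f p \<le> 1" by simp
    have "t / p * ?f p \<le> 2 * real k * ?f p"
      using k by (intro mult_right_mono) (auto simp: upset_prob_nonneg)
    with kf have "t / p * ?f p \<le> 2" by simp
    then show ?thesis
      using pos t by (simp add: field_simps)
  qed
  have upper: "(p / t) * (1 - ?f p) \<le> 2" if p: "0 \<le> p" "p \<le> 1" for p
  proof (cases "t = 1")
    case True
    have "p * (1 - ?f p) \<le> 1 * 1"
      using p by (intro mult_mono) (auto simp: upset_prob_nonneg upset_prob_le_1)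
    with True show ?thesis by simp
  next
    case False
    then have half: "?f t = 1 / 2"
      using t by simp
    define k where "k = nat \<lfloor>p / t\<rfloor>"
    have pos: "0 \<le> p / t"
      using p t by auto
    then have k: "real k \<le> p / t" "p / t - 1 \<le> real k"
      unfolding k_def by linarith+
    have kp: "real k * t \<le> p"
      using k(1) t by (simp add: field_simps)
    have le: "1 - ?f p \<le> 1 - ?f (real k * t)"
      using upset_prob_mono[OF A up, of "real k * t" p] kp t p by simp
    have "(p / t) * (1 - ?f p) \<le> (1 + real k) * (1 - ?f (real k * t))"
      using k pos le by (intro mult_mono) (auto simp: upset_prob_le_1)
    \<comment> \<open>Since \<open>f t = 1 / 2\<close>, the factor \<open>1 + k\<close> is at most
      \<open>2 * (1 + k * f t) = 2 + k\<close>.\<close>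
    also have "\<dots> \<le> 2 * ((1 - ?f (real k * t)) * (1 + real k * ?f t))"
      unfolding half using upset_prob_le_1[of A E "real k * t"] by (simp add: algebra_simps)
    also have "\<dots> \<le> 2"
      using upset_prob_multiple[OF A up, of t k] kp t p by simp
    finally show ?thesis .
  qed
  show ?thesis
    using t lower upper by (intro exI[of _ t]) auto
qed

section \<open>Random motif graphs\<close>

lemma finite_copies: "finite (copies H n)"
proof (rule finite_subset)
  show "copies H n \<subseteq> (\<lambda>(V, F). UGraph V F) ` (Pow {1..n} \<times> Pow (Pow {1..n}))"
  proof
    fix C assume "C \<in> copies H n"
    then have "verts C \<subseteq> {1..n}" "edges C \<subseteq> Pow {1..n}"
      by (auto simp: copies_def is_subgraph_def complete_graph_def)
    then show "C \<in> (\<lambda>(V, F). UGraph V F) ` (Pow {1..n} \<times> Pow (Pow {1..n}))"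
      by (intro image_eqI[of _ _ "(verts C, edges C)"]) auto
  qed
qed simp

theorem theorem1:
  fixes H :: "'a ugraph" and P :: "nat \<Rightarrow> multigraph set"
  assumes "finite_simple_graph H"
    and "no_isolated_vertices H"
    and "graph_property P"
    and "monotone_increasing P"
    and "nontrivial P"
  shows "\<exists>pstar. is_threshold H P pstar"
proof -
  \<comment> \<open>Pulling \<open>P n\<close> back along \<open>U n\<close> turns the graph
    property into an up-set of sets of copies.\<close>
  define U where "U n X = (\<Sum>C\<in>{C \<in> copies H n. X C}. mset_set (edges C))"
    for n and X :: "nat ugraph \<Rightarrow> bool"
  define f where "f n = upset_prob (copies H n) (U n -` P n)" for n
  have prob: "measure_pmf.prob (random_motif_graph H n p) (P n) = f n p" for n p
    by (simp add: random_motif_graph_def f_def upset_prob_def U_def[abs_def])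
  have U_in: "U n X \<in> multigraphs n" for n X
  proof -
    \<comment> \<open>The case of infinitely many edges is harmless because \<open>mset_set\<close>
      is then empty.\<close>
    have "set_mset (mset_set (edges C)) \<subseteq> edges (complete_graph n)" if "C \<in> copies H n" for C
      using that by (cases "finite (edges C)") (auto simp: copies_def is_subgraph_def)
    then show ?thesis
      by (auto simp: multigraphs_def U_def set_mset_sum finite_copies)
  qed
  have up: "\<forall>X\<in>U n -` P n. \<forall>Y\<ge>X. Y \<in> U n -` P n" for n
  proof (intro ballI allI impI)
    fix X Y assume X: "X \<in> U n -` P n" "X \<le> Y"
    have "{C \<in> copies H n. X C} \<subseteq> {C \<in> copies H n. Y C}"
      using X(2) by (auto simp: le_fun_def)
    then have "U n X \<subseteq># U n Y"
      unfolding U_def by (subst (2) sum.subset_diff) (auto simp: finite_copies)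
    then show "Y \<in> U n -` P n"
      using X(1) U_in assms(4) unfolding monotone_increasing_def by blast
  qed
  \<comment> \<open>If the edgeless multigraph had the property, monotonicity would give it to all
    multigraphs.\<close>
  have ev: "\<forall>\<^sub>F n in sequentially. (\<lambda>_. False) \<notin> U n -` P n"
    using assms(5) unfolding nontrivial_def
  proof eventually_elim
    case (elim n)
    then obtain G where G: "G \<in> multigraphs n" "G \<notin> P n"
      using assms(3) unfolding graph_property_def by blast
    then have "{#} \<notin> P n"
      using assms(4) unfolding monotone_increasing_def by auto
    then show ?case by (simp add: U_def)
  qed
  \<comment> \<open>A threshold must be positive for every \<open>n\<close>, so at the
    \<open>n\<close> where the empty sample has the property any positive value is accepted.\<close>
  define good where "good n t \<longleftrightarrow> t > 0 \<and> ((\<lambda>_. False) \<notin> U n -` P n \<longrightarrow>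
      (\<forall>p\<in>{0..1}. f n p \<le> 2 * (p / t) \<and> (p / t) * (1 - f n p) \<le> 2))" for n t
  have "\<exists>t. good n t" for n
  proof (cases "(\<lambda>_. False) \<in> U n -` P n")
    case True
    then show ?thesis
      unfolding good_def by (intro exI[of _ 1]) simp
  next
    case False
    from upset_prob_threshold[OF finite_copies[of H n] up False] show ?thesis
      unfolding good_def f_def by (elim ex_forward) (intro conjI impI; elim conjE; assumption)
  qed
  then have good: "good n (SOME t. good n t)" for n
    by (rule someI_ex)
  define t where "t n = (SOME t. good n t)" for n
  have t: "t n > 0" for n
    using good[of n] unfolding good_def t_def by (elim conjE)
  have bounds: "f n p \<le> 2 * (p / t n)" "(p / t n) * (1 - f n p) \<le> 2"
    if "(\<lambda>_. False) \<notin> U n -` P n" "0 \<le> p" "p \<le> 1" for n p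
    using good[of n, folded t_def] that unfolding good_def atLeastAtMost_iff Ball_def
    by (elim conjE impE; simp)+
  have "is_threshold H P t"
    unfolding is_threshold_def prob
  proof (intro conjI allI impI)
    fix p :: "nat \<Rightarrow> real"
    assume p: "\<forall>n. 0 \<le> p n \<and> p n \<le> 1" and lim: "(\<lambda>n. p n / t n) \<longlonglongrightarrow> 0"
    have bound: "(\<lambda>n. 2 * (p n / t n)) \<longlonglongrightarrow> 0"
      using tendsto_mult_left[OF lim, of 2] by simp
    have le: "\<forall>\<^sub>F n in sequentially. f n (p n) \<le> 2 * (p n / t n)"
      using ev by eventually_elim (use p bounds in simp)
    have nonneg: "\<forall>\<^sub>F n in sequentially. 0 \<le> f n (p n)"
      by (simp add: f_def upset_prob_nonneg)
    show "(\<lambda>n. f n (p n)) \<longlonglongrightarrow> 0"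
      by (rule tendsto_sandwich[OF nonneg le tendsto_const bound])
  next
    fix p :: "nat \<Rightarrow> real"
    assume p: "\<forall>n. 0 \<le> p n \<and> p n \<le> 1"
      and lim: "filterlim (\<lambda>n. p n / t n) at_top sequentially"
    have bound: "(\<lambda>n. 1 - 2 / (p n / t n)) \<longlonglongrightarrow> 1"
      using tendsto_diff[OF tendsto_const
        tendsto_divide_0[OF tendsto_const filterlim_at_top_imp_at_infinity[OF lim]], of 1 2]
      by simp
    have ge: "\<forall>\<^sub>F n in sequentially. 1 - 2 / (p n / t n) \<le> f n (p n)"
      \<comment> \<open>Divergence makes the ratio \<open>p n / t n\<close> eventually positive, so
        that it can be divided by.\<close>
      using ev filterlim_at_top_dense[THEN iffD1, OF lim, rule_format, of 0]
    proof eventually_elim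
      case (elim n)
      then have "(p n / t n) * (1 - f n (p n)) \<le> 2"
        using p bounds by simp
      then have "1 - f n (p n) \<le> 2 / (p n / t n)"
        using elim(2) by (subst pos_le_divide_eq) (auto simp: mult.commute)
      then show ?case by linarith
    qed
    have le_1: "\<forall>\<^sub>F n in sequentially. f n (p n) \<le> 1"
      by (simp add: f_def upset_prob_le_1)
    show "(\<lambda>n. f n (p n)) \<longlonglongrightarrow> 1"
      by (rule tendsto_sandwich[OF ge le_1 bound tendsto_const])
  qed (rule t)
  then show ?thesis by blast
qed

end
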